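(* Let $$y(\mu;x)=\sum_{k=0}^\infty y_k\frac{(\mu)_k}{(2\mu)_k\,k!}x^k$$ with any non-negative sequence $\{y_k\}_{k=0}^\infty$ independent of $\mu$. Then for any $\alpha,\beta>0$ the generalized Turánian $$\Delta_y(\alpha,\beta;x)=y(\mu+\alpha;x)y(\mu+\beta;x)-y(\mu;x)y(\mu+\alpha+\beta;x)=\sum_{m=2}^\infty\bar\phi_mx^m$$ has negative power series coefficients, $\bar\phi_m<0$, so that the function $\mu\mapsto y(\mu;x)$ is coefficient-wise log-convex for $\mu>0$.
   Context: $(\mu)_n$ is the rising factorial: $(\mu)_0=1$, $(\mu)_n=\mu(\mu+1)\cdots(\mu+n-1)$. The series is regarded as a formal power series in $x$. "Coefficient-wise log-convex for $\mu>0$" means that for all $\mu>0$ and all $\alpha,\beta\ge0$ every coefficient of $\Delta_y(\alpha,\beta;x)$ in powers of $x$ is $\le0$.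
   Formalization: Strict negativity of the m-th coefficient (m ≥ 2) is claimed only if y_k > 0 and y_{m-k} > 0 for some k with 2 ≤ k ≤ m (otherwise it is 0, e.g. for y = 0); for every non-negative sequence the coefficients are shown to be ≤ 0. *)

theory Defs
  imports Complex_Main "HOL-Computational_Algebra.Formal_Power_Series"
begin

definition y_series :: "(nat \<Rightarrow> real) \<Rightarrow> real \<Rightarrow> real fps" where
  "y_series y \<mu> = Abs_fps (\<lambda>k. y k * pochhammer \<mu> k / (pochhammer (2 * \<mu>) k * fact k))"

definition turanian :: "(real \<Rightarrow> real fps) \<Rightarrow> real \<Rightarrow> real \<Rightarrow> real \<Rightarrow> real fps" where
  "turanian f \<mu> \<alpha> \<beta> = f (\<mu> + \<alpha>) * f (\<mu> + \<beta>) - f \<mu> * f (\<mu> + \<alpha> + \<beta>)"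

definition coeffwise_log_convex_pos :: "(real \<Rightarrow> real fps) \<Rightarrow> bool" where
  "coeffwise_log_convex_pos f \<longleftrightarrow>
     (\<forall>\<mu>>0. \<forall>\<alpha>\<ge>0. \<forall>\<beta>\<ge>0. \<forall>m. fps_nth (turanian f \<mu> \<alpha> \<beta>) m \<le> 0)"

text \<open>
  The coefficient of \<open>x^m\<close> in the Turanian of \<^term>\<open>y_series y\<close> is a sum over \<open>i + j = m\<close>
  of multiples of \<open>y i * y j\<close>, and the multiple of \<open>y 1 * y 1\<close> is identically zero.  For a
  merely non-negative \<open>y\<close> a coefficient can therefore vanish (for example if \<open>y\<close> is zero),
  so strict negativity of the \<open>m\<close>-th coefficient needs a product \<open>y i * y j > 0\<close> with
  \<open>i + j = m\<close> and \<open>(i, j) \<noteq> (1, 1)\<close>.  For \<open>m \<ge> 2\<close> and up to swapping \<open>i\<close> and \<open>j\<close> this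
  says that \<open>y k > 0\<close> and \<open>y (m - k) > 0\<close> for some \<open>k\<close> in \<open>{2..m}\<close>.  If \<open>y\<close> is
  positive, \<open>k = m\<close> is such an index for every \<open>m \<ge> 2\<close>.
\<close>

end

(* Write (x)_k / (2x)_k as the product over j < k of g_j(x) = (x + j) / (2 x + j).  Each g_j is
   positive, decreasing and log-convex on x > 0, strictly so for j > 0.  Symmetrizing the
   coefficient of x^m over k + l = m, say with k <= l, leaves the combinations
   p1 q2 + q1 p2 - p0 q3 - q0 p3 of p = (x)_k / (2x)_k and q = (x)_l / (2x)_l = p r, where the indices 0, 1, 2, 3
   are the points mu, mu + alpha, mu + beta, mu + alpha + beta.  They are nonpositive because
   p1 p2 <= p0 p3 (log-convexity of p) and r1 + r2 <= r0 + r3, which follows from r1 r2 <= r0 r3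
   and (r0 - r1) (r0 - r2) >= 0. *)
theory Submission
  imports Defs
begin

section \<open>Single factors: monotonicity and log-convexity\<close>

definition poch_factor :: "nat \<Rightarrow> real \<Rightarrow> real" where
  "poch_factor j x = (x + real j) / (2 * x + real j)"

definition poch_ratio :: "nat \<Rightarrow> real \<Rightarrow> real" where
  "poch_ratio k x = pochhammer x k / pochhammer (2 * x) k"

lemma poch_ratio_prod: "poch_ratio k x = (\<Prod>j<k. poch_factor j x)"
  by (simp add: poch_ratio_def poch_factor_def pochhammer_prod prod_dividef lessThan_atLeast0)

lemma poch_factor_pos: "x > 0 \<Longrightarrow> poch_factor j x > 0"
  by (simp add: poch_factor_def add_pos_nonneg)

text \<open>After cross-multiplying, the terms \<open>2 * x * z\<close> and \<open>j^2\<close>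
  cancel and only \<open>j * x \<le> j * z\<close> remains.\<close>

lemma poch_factor_antimono:
  assumes "0 < x" "x \<le> z"
  shows "poch_factor j z \<le> poch_factor j x"
proof -
  have "real j * x \<le> real j * z"
    using assms by (intro mult_left_mono) auto
  then show ?thesis
    using assms unfolding poch_factor_def
    by (subst frac_le_eq) (auto simp: add_pos_nonneg divide_le_0_iff algebra_simps)
qed

text \<open>For fixed \<open>x + x'\<close>, the product of the factors at \<open>x\<close> and \<open>x'\<close> is a decreasing function of
  the product \<open>x * x'\<close>.\<close>
lemma poch_factor_mult_diff:
  fixes \<mu> \<alpha> \<beta> :: real and j :: nat
  assumes "\<mu> > 0" "\<alpha> \<ge> 0" "\<beta> \<ge> 0"
  defines "D \<equiv> (2 * \<mu> + real j) * (2 * (\<mu> + \<alpha> + \<beta>) + real j)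
                * ((2 * (\<mu> + \<alpha>) + real j) * (2 * (\<mu> + \<beta>) + real j))"
  shows "poch_factor j \<mu> * poch_factor j (\<mu> + \<alpha> + \<beta>)
           - poch_factor j (\<mu> + \<alpha>) * poch_factor j (\<mu> + \<beta>)
         = \<alpha> * \<beta> * real j * (2 * (2 * \<mu> + \<alpha> + \<beta>) + 3 * real j) / D"
    and "D > 0"
proof -
  have *: "2 * \<mu> + real j > 0" "2 * (\<mu> + \<alpha> + \<beta>) + real j > 0"
    "2 * (\<mu> + \<alpha>) + real j > 0" "2 * (\<mu> + \<beta>) + real j > 0"
    using assms by auto
  then show "D > 0" unfolding D_def by simp
  \<comment> \<open>This brings the difference over one denominator whose factors are ordered as in
    \<open>D\<close>, so only numerators are left to compare.\<close>
  have frac: "(a / b) * (c / d) - (a' / b') * (c' / d')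
      = (a * c * (b' * d') - a' * c' * (b * d)) / (b * d * (b' * d'))"
    if "b > 0" "d > 0" "b' > 0" "d' > 0" for a b c d a' b' c' d' :: real
    using that by (simp add: diff_frac_eq)
  show "poch_factor j \<mu> * poch_factor j (\<mu> + \<alpha> + \<beta>)
           - poch_factor j (\<mu> + \<alpha>) * poch_factor j (\<mu> + \<beta>)
         = \<alpha> * \<beta> * real j * (2 * (2 * \<mu> + \<alpha> + \<beta>) + 3 * real j) / D"
    unfolding poch_factor_def D_def frac[OF *]
    by (rule arg_cong[where f = "\<lambda>t. t / _"]) (simp add: algebra_simps)
qed

lemma poch_factor_log_convex:
  assumes "\<mu> > 0" "\<alpha> \<ge> 0" "\<beta> \<ge> 0"
  shows "poch_factor j (\<mu> + \<alpha>) * poch_factor j (\<mu> + \<beta>)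
         \<le> poch_factor j \<mu> * poch_factor j (\<mu> + \<alpha> + \<beta>)"
proof -
  have "0 \<le> poch_factor j \<mu> * poch_factor j (\<mu> + \<alpha> + \<beta>)
           - poch_factor j (\<mu> + \<alpha>) * poch_factor j (\<mu> + \<beta>)"
    unfolding poch_factor_mult_diff(1)[OF assms]
    using assms poch_factor_mult_diff(2)[OF assms, of j]
    by (intro divide_nonneg_pos mult_nonneg_nonneg) auto
  then show ?thesis by simp
qed

text \<open>The numerator of the difference carries the factor
  \<open>\<alpha> * \<beta> * j\<close>. At \<open>j = 0\<close> strictness fails, since
  \<open>poch_factor 0\<close> is constantly 1/2 on the positive axis.\<close>

lemma poch_factor_log_convex_strict:
  assumes "\<mu> > 0" "\<alpha> > 0" "\<beta> > 0" "j > 0"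
  shows "poch_factor j (\<mu> + \<alpha>) * poch_factor j (\<mu> + \<beta>)
         < poch_factor j \<mu> * poch_factor j (\<mu> + \<alpha> + \<beta>)"
proof -
  have le: "\<alpha> \<ge> 0" "\<beta> \<ge> 0" using assms by auto
  have "0 < poch_factor j \<mu> * poch_factor j (\<mu> + \<alpha> + \<beta>)
           - poch_factor j (\<mu> + \<alpha>) * poch_factor j (\<mu> + \<beta>)"
    unfolding poch_factor_mult_diff(1)[OF assms(1) le]
    using assms poch_factor_mult_diff(2)[OF assms(1) le, of j]
    by (intro divide_pos_pos mult_pos_pos add_pos_pos) auto
  then show ?thesis by simp
qed

section \<open>Products of factors over an index set\<close>

lemma prod_poch_factor_pos: "x > 0 \<Longrightarrow> (\<Prod>j\<in>A. poch_factor j x) > 0"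
  by (intro prod_pos) (simp add: poch_factor_pos)

lemma prod_poch_factor_antimono:
  assumes "0 < x" "x \<le> z"
  shows "(\<Prod>j\<in>A. poch_factor j z) \<le> (\<Prod>j\<in>A. poch_factor j x)"
  using assms poch_factor_pos[of z] by (intro prod_mono) (auto intro: poch_factor_antimono less_imp_le)

lemma prod_poch_factor_log_convex:
  assumes "\<mu> > 0" "\<alpha> \<ge> 0" "\<beta> \<ge> 0"
  shows "(\<Prod>j\<in>A. poch_factor j (\<mu> + \<alpha>)) * (\<Prod>j\<in>A. poch_factor j (\<mu> + \<beta>))
         \<le> (\<Prod>j\<in>A. poch_factor j \<mu>) * (\<Prod>j\<in>A. poch_factor j (\<mu> + \<alpha> + \<beta>))"
  unfolding prod.distrib[symmetric]
  using assms
  by (intro prod_mono conjI poch_factor_log_convex mult_nonneg_nonneg)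
     (auto intro!: less_imp_le poch_factor_pos)

text \<open>One strict factor, at the positive index \<open>i\<close>, suffices: the others satisfy
  the weak inequality and are positive.\<close>

lemma prod_poch_factor_log_convex_strict:
  assumes "\<mu> > 0" "\<alpha> > 0" "\<beta> > 0" and "finite A" "i \<in> A" "i > 0"
  shows "(\<Prod>j\<in>A. poch_factor j (\<mu> + \<alpha>)) * (\<Prod>j\<in>A. poch_factor j (\<mu> + \<beta>))
         < (\<Prod>j\<in>A. poch_factor j \<mu>) * (\<Prod>j\<in>A. poch_factor j (\<mu> + \<alpha> + \<beta>))"
proof -
  let ?f = "\<lambda>j. poch_factor j (\<mu> + \<alpha>) * poch_factor j (\<mu> + \<beta>)"
  let ?h = "\<lambda>j. poch_factor j \<mu> * poch_factor j (\<mu> + \<alpha> + \<beta>)"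
  have pos: "?f j > 0" for j
    using assms by (simp add: poch_factor_pos)
  have "?f i * prod ?f (A - {i}) < ?h i * prod ?h (A - {i})"
  proof (rule mult_less_le_imp_less)
    show "?f i < ?h i"
      using assms by (intro poch_factor_log_convex_strict)
    show "prod ?f (A - {i}) \<le> prod ?h (A - {i})"
      using assms pos by (intro prod_mono conjI poch_factor_log_convex) (auto intro: less_imp_le)
  qed (use pos in \<open>auto intro: less_imp_le prod_pos\<close>)
  then show ?thesis
    unfolding prod.distrib[symmetric] using assms by (simp add: prod.remove)
qed

text \<open>Expanding \<open>(r0 - r1) * (r0 - r2) \<ge> 0\<close> gives
  \<open>r0 * (r1 + r2) \<le> r0^2 + r1 * r2 \<le> r0 * (r0 + r3)\<close>; then divide by
  \<open>r0\<close>.\<close>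

lemma add_le_add_of_mult_le_mult:
  fixes r0 r1 r2 r3 :: real
  assumes "0 < r0" "r1 \<le> r0" "r2 \<le> r0" "r1 * r2 \<le> r0 * r3"
  shows "r1 + r2 \<le> r0 + r3"
proof -
  have "0 \<le> (r0 - r1) * (r0 - r2)" using assms by simp
  then have "r0 * (r1 + r2) \<le> r0 * (r0 + r3)"
    using assms(4) by (simp add: algebra_simps)
  then show ?thesis using assms(1) by simp
qed

lemma add_less_add_of_mult_less_mult:
  fixes r0 r1 r2 r3 :: real
  assumes "0 < r0" "r1 \<le> r0" "r2 \<le> r0" "r1 * r2 < r0 * r3"
  shows "r1 + r2 < r0 + r3"
proof -
  have "0 \<le> (r0 - r1) * (r0 - r2)" using assms by simp
  then have "r0 * (r1 + r2) < r0 * (r0 + r3)"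
    using assms(4) by (simp add: algebra_simps)
  then show ?thesis using assms(1) by simp
qed

section \<open>Sign of the symmetrized Turanian\<close>

text \<open>The contributions of (k, l) and (l, k) are added because one alone has no fixed sign:
  (0, l) gives a nonnegative term and (l, 0) a nonpositive one.\<close>

definition sym_turanian :: "nat \<Rightarrow> nat \<Rightarrow> real \<Rightarrow> real \<Rightarrow> real \<Rightarrow> real" where
  "sym_turanian k l \<mu> \<alpha> \<beta> =
     poch_ratio k (\<mu> + \<alpha>) * poch_ratio l (\<mu> + \<beta>) + poch_ratio l (\<mu> + \<alpha>) * poch_ratio k (\<mu> + \<beta>)
     - poch_ratio k \<mu> * poch_ratio l (\<mu> + \<alpha> + \<beta>) - poch_ratio l \<mu> * poch_ratio k (\<mu> + \<alpha> + \<beta>)"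

lemma sym_turanian_commute: "sym_turanian k l \<mu> \<alpha> \<beta> = sym_turanian l k \<mu> \<alpha> \<beta>"
  by (simp add: sym_turanian_def)

text \<open>The ratio at \<open>l\<close> is \<open>p * r\<close>, so \<open>p\<close> occurs in
  every term and factors out. The sign question separates into log-convexity of \<open>p\<close> and
  an inequality between sums of values of \<open>r\<close>.\<close>

lemma sym_turanian_split:
  assumes "k \<le> l"
  defines "p \<equiv> \<lambda>x. \<Prod>j<k. poch_factor j x" and "r \<equiv> \<lambda>x. \<Prod>j=k..<l. poch_factor j x"
  shows "sym_turanian k l \<mu> \<alpha> \<beta>
         = p (\<mu> + \<alpha>) * p (\<mu> + \<beta>) * (r (\<mu> + \<alpha>) + r (\<mu> + \<beta>))
           - p \<mu> * p (\<mu> + \<alpha> + \<beta>) * (r \<mu> + r (\<mu> + \<alpha> + \<beta>))"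
proof -
  have "poch_ratio l x = p x * r x" for x
    unfolding poch_ratio_prod p_def r_def lessThan_atLeast0
    using assms(1) by (simp add: prod.atLeastLessThan_concat)
  moreover have "poch_ratio k x = p x" for x
    by (simp add: poch_ratio_prod p_def)
  ultimately show ?thesis
    by (simp add: sym_turanian_def algebra_simps)
qed

lemma sym_turanian_nonpos:
  assumes "\<mu> > 0" "\<alpha> \<ge> 0" "\<beta> \<ge> 0"
  shows "sym_turanian k l \<mu> \<alpha> \<beta> \<le> 0"
proof (induction k l rule: linorder_wlog)
  case (le k l)
  have "(\<Prod>j=k..<l. poch_factor j (\<mu> + \<alpha>)) + (\<Prod>j=k..<l. poch_factor j (\<mu> + \<beta>))
     \<le> (\<Prod>j=k..<l. poch_factor j \<mu>) + (\<Prod>j=k..<l. poch_factor j (\<mu> + \<alpha> + \<beta>))"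
    using assms
    by (intro add_le_add_of_mult_le_mult prod_poch_factor_pos prod_poch_factor_antimono
        prod_poch_factor_log_convex) auto
  then show ?case
    unfolding sym_turanian_split[OF le] diff_le_0_iff_le
    using assms
    by (intro mult_mono prod_poch_factor_log_convex)
       (auto intro!: mult_nonneg_nonneg add_nonneg_nonneg less_imp_le[OF prod_poch_factor_pos])
qed (simp add: sym_turanian_commute)

text \<open>With \<open>k \<le> l\<close> and \<open>l \<ge> 2\<close>, the factor of index
  \<open>l - 1 \<ge> 1\<close> is strictly log-convex; it lies in \<open>p\<close> if
  \<open>k = l\<close> and in \<open>r\<close> otherwise.\<close>

lemma sym_turanian_neg:
  assumes "\<mu> > 0" "\<alpha> > 0" "\<beta> > 0" "2 \<le> k \<or> 2 \<le> l"
  shows "sym_turanian k l \<mu> \<alpha> \<beta> < 0"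
  using assms(4)
proof (induction k l rule: linorder_wlog)
  case (le k l)
  let ?p = "\<lambda>x. \<Prod>j<k. poch_factor j x" and ?r = "\<lambda>x. \<Prod>j=k..<l. poch_factor j x"
  have pos: "\<mu> + \<alpha> > 0" "\<mu> + \<beta> > 0" "\<mu> + \<alpha> + \<beta> > 0"
    using assms by auto
  note pos' = assms(1) pos
  have "l \<ge> 2" using le by auto
  have "?p (\<mu> + \<alpha>) * ?p (\<mu> + \<beta>) * (?r (\<mu> + \<alpha>) + ?r (\<mu> + \<beta>))
        < ?p \<mu> * ?p (\<mu> + \<alpha> + \<beta>) * (?r \<mu> + ?r (\<mu> + \<alpha> + \<beta>))"
  proof (cases "k = l")
    case True
    \<comment> \<open>Here \<open>?r\<close> is an empty product, constantly 1, so strictness must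
      come from \<open>?p\<close>, which contains the factor of index 1.\<close>
    have "?p (\<mu> + \<alpha>) * ?p (\<mu> + \<beta>) < ?p \<mu> * ?p (\<mu> + \<alpha> + \<beta>)"
      using assms \<open>l \<ge> 2\<close> True by (intro prod_poch_factor_log_convex_strict[where i = 1]) auto
    then show ?thesis using True by simp
  next
    case False
    \<comment> \<open>Now strictness must come from \<open>?r\<close>: for \<open>k \<le> 1\<close>
      the product \<open>?p\<close> is constant on the positive axis.\<close>
    then have "l - 1 \<in> {k..<l}" "l - 1 > 0" using le \<open>l \<ge> 2\<close> by auto
    then have "?r (\<mu> + \<alpha>) + ?r (\<mu> + \<beta>) < ?r \<mu> + ?r (\<mu> + \<alpha> + \<beta>)"
      using assms
      by (intro add_less_add_of_mult_less_mult prod_poch_factor_pos prod_poch_factor_antimono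
          prod_poch_factor_log_convex_strict[where i = "l - 1"]) auto
    moreover have "?p (\<mu> + \<alpha>) * ?p (\<mu> + \<beta>) \<le> ?p \<mu> * ?p (\<mu> + \<alpha> + \<beta>)"
      using assms by (intro prod_poch_factor_log_convex) auto
    ultimately show ?thesis
      using pos'
      by (intro mult_le_less_imp_less)
         (auto intro!: mult_pos_pos add_nonneg_nonneg less_imp_le[OF prod_poch_factor_pos]
            prod_poch_factor_pos)
  qed
  then show ?case
    unfolding sym_turanian_split[OF le(1)] by simp
qed (metis sym_turanian_commute)

text \<open>Both ratios are constant in the parameter here. Hence the coefficients of degree 0 and 1
  vanish, and the pair (1, 1) adds nothing in degree 2.\<close>

lemma sym_turanian_eq_0:
  assumes "\<mu> > 0" "\<alpha> \<ge> 0" "\<beta> \<ge> 0" "k < 2" "l < 2"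
  shows "sym_turanian k l \<mu> \<alpha> \<beta> = 0"
proof -
  have const: "poch_ratio n x = (if n = 0 then 1 else 1 / 2)" if "x > 0" "n < 2" for n x
    using that by (auto simp: poch_ratio_def less_2_cases_iff)
  show ?thesis
    unfolding sym_turanian_def using assms by (simp add: const)
qed

section \<open>Coefficients of the Turanian\<close>

text \<open>The weight is invariant under the reversal of \<open>k\<close> to \<open>m - k\<close>,
  so adding the Cauchy sum to its reversal doubles it and symmetrizes each term.\<close>

lemma turanian_y_series_nth:
  "2 * fps_nth (turanian (y_series y) \<mu> \<alpha> \<beta>) m
   = (\<Sum>k\<le>m. y k * y (m - k) / (fact k * fact (m - k)) * sym_turanian k (m - k) \<mu> \<alpha> \<beta>)"
proof -
  define w where "w k = y k * y (m - k) / (fact k * fact (m - k))" for k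
  define d where "d k l = poch_ratio k (\<mu> + \<alpha>) * poch_ratio l (\<mu> + \<beta>)
      - poch_ratio k \<mu> * poch_ratio l (\<mu> + \<alpha> + \<beta>)" for k l
  have "fps_nth (turanian (y_series y) \<mu> \<alpha> \<beta>) m = (\<Sum>k\<le>m. w k * d k (m - k))"
    unfolding turanian_def fps_sub_nth fps_mult_nth sum_subtractf[symmetric] atLeast0AtMost
    by (intro sum.cong)
       (simp_all add: y_series_def w_def d_def poch_ratio_def right_diff_distrib mult_ac)
  moreover have "(\<Sum>k\<le>m. w k * d k (m - k)) = (\<Sum>k\<le>m. w k * d (m - k) k)"
    by (rule sum.reindex_bij_witness[where i = "\<lambda>k. m - k" and j = "\<lambda>k. m - k"])
       (auto simp: w_def mult_ac)
  ultimately have "2 * fps_nth (turanian (y_series y) \<mu> \<alpha> \<beta>) m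
      = (\<Sum>k\<le>m. w k * (d k (m - k) + d (m - k) k))"
    by (simp add: distrib_left sum.distrib)
  then show ?thesis
    by (simp add: w_def d_def sym_turanian_def algebra_simps)
qed

lemma turanian_y_series_nonpos:
  assumes "\<And>k. 0 \<le> y k" "\<mu> > 0" "\<alpha> \<ge> 0" "\<beta> \<ge> 0"
  shows "fps_nth (turanian (y_series y) \<mu> \<alpha> \<beta>) m \<le> 0"
proof -
  have "2 * fps_nth (turanian (y_series y) \<mu> \<alpha> \<beta>) m \<le> 0"
    unfolding turanian_y_series_nth
    using assms by (intro sum_nonpos mult_nonneg_nonpos sym_turanian_nonpos) auto
  then show ?thesis by simp
qed

lemma turanian_y_series_neg:
  assumes "\<And>k. 0 \<le> y k" "\<mu> > 0" "\<alpha> > 0" "\<beta> > 0"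
    and "2 \<le> k" "k \<le> m" "0 < y k" "0 < y (m - k)"
  shows "fps_nth (turanian (y_series y) \<mu> \<alpha> \<beta>) m < 0"
proof -
  define t where "t k = y k * y (m - k) / (fact k * fact (m - k)) * sym_turanian k (m - k) \<mu> \<alpha> \<beta>" for k
  have "sum t {..m} < (\<Sum>k\<le>m. 0)"
  proof (rule sum_strict_mono_ex1)
    show "\<forall>i\<in>{..m}. t i \<le> 0"
      unfolding t_def using assms by (intro ballI mult_nonneg_nonpos sym_turanian_nonpos) auto
    \<comment> \<open>The weight is positive by the assumptions on \<open>y\<close>, and
      \<open>2 \<le> k\<close> makes the symmetrized factor negative.\<close>
    have "t k < 0"
      unfolding t_def using assms by (intro mult_pos_neg sym_turanian_neg) auto
    then show "\<exists>i\<in>{..m}. t i < 0" using assms by auto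
  qed simp
  then show ?thesis
    using turanian_y_series_nth[of y \<mu> \<alpha> \<beta> m] by (simp add: t_def)
qed

lemma turanian_y_series_eq_0:
  assumes "\<mu> > 0" "\<alpha> \<ge> 0" "\<beta> \<ge> 0" "m < 2"
  shows "fps_nth (turanian (y_series y) \<mu> \<alpha> \<beta>) m = 0"
proof -
  have "2 * fps_nth (turanian (y_series y) \<mu> \<alpha> \<beta>) m = 0"
    unfolding turanian_y_series_nth
    using assms by (intro sum.neutral) (auto simp: sym_turanian_eq_0)
  then show ?thesis by simp
qed

theorem theorem5p1:
  fixes y :: "nat \<Rightarrow> real"
  assumes "\<And>k. 0 \<le> y k"
  shows "(\<forall>\<mu>>0. \<forall>\<alpha>>0. \<forall>\<beta>>0.
            (\<forall>m<2. fps_nth (turanian (y_series y) \<mu> \<alpha> \<beta>) m = 0) \<and>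
            (\<forall>m\<ge>2. fps_nth (turanian (y_series y) \<mu> \<alpha> \<beta>) m \<le> 0 \<and>
                    ((\<exists>k\<in>{2..m}. 0 < y k \<and> 0 < y (m - k)) \<longrightarrow>
                       fps_nth (turanian (y_series y) \<mu> \<alpha> \<beta>) m < 0)))
         \<and> coeffwise_log_convex_pos (y_series y)"
  unfolding coeffwise_log_convex_pos_def
proof (intro conjI allI impI)
  fix \<mu> \<alpha> \<beta> :: real and m :: nat
  assume pos: "\<mu> > 0" "\<alpha> > 0" "\<beta> > 0"
  show "fps_nth (turanian (y_series y) \<mu> \<alpha> \<beta>) m = 0" if "m < 2"
    using pos that by (simp add: turanian_y_series_eq_0)
  show "fps_nth (turanian (y_series y) \<mu> \<alpha> \<beta>) m \<le> 0"
    using pos by (simp add: turanian_y_series_nonpos assms)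
  show "fps_nth (turanian (y_series y) \<mu> \<alpha> \<beta>) m < 0"
    if "\<exists>k\<in>{2..m}. 0 < y k \<and> 0 < y (m - k)"
    using that pos turanian_y_series_neg[OF assms] by auto
qed (simp add: turanian_y_series_nonpos assms)

end
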